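(* (a) For every $K_3N$ $n=pqr$, $B<2p-\sqrt{p-\frac34}+\dfrac{\sqrt3+1}{2\sqrt3}$. (b) For every $C_3N$ $n=pqr$, $B<2p-\sqrt{p-\frac34}+\dfrac{\sqrt7+1}{2\sqrt7}$.
   Context: A $K_3N$ (Korselt number with three factors) is an integer $n$ together with a factorisation $n=pqr$, where $1<p<q<r$ are odd integers (not necessarily prime) such that each of $p-1,\ q-1,\ r-1$ divides $n-1$, and such that $E:=\dfrac{pq-1}{r-1}$ (which is an integer by the divisibility condition) satisfies $E\ge 2$. A $C_3N$ is a Carmichael number with exactly three prime factors $p<q<r$, i.e. a $K_3N$ $n=pqr$ in which $p,q,r$ are all prime. Put $H:=\gcd(p-1,q-1,r-1)$ and $B:=\frac{q-1}{H}$. *)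

theory Defs
  imports Complex_Main "HOL-Number_Theory.Number_Theory"
begin

text \<open>
  The differences $p-1$ etc. are natural-number subtractions; they never truncate, since
  $1 < p < q < r$.
\<close>

definition K3N_E :: "nat \<Rightarrow> nat \<Rightarrow> nat \<Rightarrow> real" where
  "K3N_E p q r = real (p * q - 1) / real (r - 1)"

definition K3N_H :: "nat \<Rightarrow> nat \<Rightarrow> nat \<Rightarrow> nat" where
  "K3N_H p q r = gcd (p - 1) (gcd (q - 1) (r - 1))"

definition K3N_B :: "nat \<Rightarrow> nat \<Rightarrow> nat \<Rightarrow> real" where
  "K3N_B p q r = real (q - 1) / real (K3N_H p q r)"

definition K3N :: "nat \<Rightarrow> nat \<Rightarrow> nat \<Rightarrow> nat \<Rightarrow> bool" where
  "K3N n p q r \<longleftrightarrow>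
     n = p * q * r \<and> 1 < p \<and> p < q \<and> q < r \<and> odd p \<and> odd q \<and> odd r \<and>
     (p - 1) dvd (n - 1) \<and> (q - 1) dvd (n - 1) \<and> (r - 1) dvd (n - 1) \<and>
     K3N_E p q r \<ge> 2"

definition carmichael_number :: "nat \<Rightarrow> bool" where
  "carmichael_number n \<longleftrightarrow>
     n > 1 \<and> \<not> prime n \<and> (\<forall>a. coprime a n \<longrightarrow> [a ^ (n - 1) = 1] (mod n))"

definition C3N :: "nat \<Rightarrow> nat \<Rightarrow> nat \<Rightarrow> nat \<Rightarrow> bool" where
  "C3N n p q r \<longleftrightarrow>
     carmichael_number n \<and> n = p * q * r \<and> p < q \<and> q < r \<and> prime p \<and> prime q \<and> prime r"

text \<open>
  Divisibility makes the quotient $E$ an integer, and a $C_3N$ is precisely a $K_3N$ whose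
  three factors are prime.
\<close>

lemma K3N_E_int:
  assumes "K3N n p q r"
  shows "K3N_E p q r \<in> \<int>"
proof -
  have h: "n = p * q * r" "1 < p" "p < q" "q < r" "(r - 1) dvd (n - 1)"
    using assms by (auto simp: K3N_def)
  obtain s where s: "r = Suc s" using h by (cases r) auto
  have "1 \<le> p * q" using h by (simp add: Suc_leI)
  then have "n - 1 = p * q * s + (p * q - 1)" using h s by simp
  then have "s dvd p * q - 1" using h(5) s
    by (simp add: dvd_add_right_iff)
  then obtain k where "p * q - 1 = s * k" by (auto simp: dvd_def)
  then have "K3N_E p q r = real k" using h s by (simp add: K3N_E_def del: of_nat_mult) simp
  then show ?thesis by simp
qed

lemma carmichael_number_pqr_iff:
  assumes "prime p" "prime q" "prime r" "p < q" "q < r" and n: "n = p * q * r"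
  shows "carmichael_number n \<longleftrightarrow>
           (p - 1) dvd (n - 1) \<and> (q - 1) dvd (n - 1) \<and> (r - 1) dvd (n - 1)"
proof -
  have gt: "p > 1" "q > 1" "r > 1" using assms prime_gt_1_nat by blast+
  have cop: "coprime p q" "coprime (p * q) r"
    using assms by (auto simp: primes_coprime)
  have C: "Carmichael n = lcm (lcm (p - 1) (q - 1)) (r - 1)"
    using cop assms by (simp add: Carmichael_mult_coprime Carmichael_prime)
  have n1: "n > 1" using gt unfolding n by (intro less_1_mult)
  have np: "\<not> prime n"
  proof
    assume "prime n"
    then have "p * q = 1 \<or> r = 1" unfolding n by (rule prime_product)
    then show False using gt by simp
  qed
  have "(\<forall>a. coprime a n \<longrightarrow> [a ^ (n - 1) = 1] (mod n)) \<longleftrightarrow> Carmichael n dvd n - 1"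
  proof
    assume a: "\<forall>a. coprime a n \<longrightarrow> [a ^ (n - 1) = 1] (mod n)"
    have "ord n a dvd n - 1" if "a \<in> totatives n" for a
      using a that by (metis in_totatives_iff ord_divides)
    then show "Carmichael n dvd n - 1"
      unfolding Carmichael_def by (intro Lcm_least) auto
  next
    assume "Carmichael n dvd n - 1"
    then show "\<forall>a. coprime a n \<longrightarrow> [a ^ (n - 1) = 1] (mod n)"
      using Carmichael_divides coprime_commute by blast
  qed
  then show ?thesis using n1 np C by (auto simp: carmichael_number_def)
qed

lemma C3N_iff_K3N:
  "C3N n p q r \<longleftrightarrow> K3N n p q r \<and> prime p \<and> prime q \<and> prime r"
proof
  assume c: "C3N n p q r"
  then have h: "n = p * q * r" "p < q" "q < r" and pr: "prime p" "prime q" "prime r"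
    by (auto simp: C3N_def)
  have d: "(p - 1) dvd (n - 1)" "(q - 1) dvd (n - 1)" "(r - 1) dvd (n - 1)"
    using c h pr carmichael_number_pqr_iff[of p q r n] by (auto simp: C3N_def)
  have p1: "1 < p" using pr prime_gt_1_nat by blast
  have rodd: "odd r" and qodd: "odd q"
    using pr h p1 prime_odd_nat[of r] prime_odd_nat[of q] by auto
  have "even (r - 1)" using rodd by simp
  then have "even (n - 1)" using d(3) by (rule dvd_trans)
  moreover have "n > 0" using h p1 by simp
  ultimately have nodd: "odd n" by simp
  then have podd: "odd p" using h by simp
  obtain s where s: "r = Suc s" using h by (cases r) auto
  have "1 \<le> p * q" using h p1 by (simp add: Suc_leI)
  then have "n - 1 = p * q * s + (p * q - 1)" using h s by simp
  then have "s dvd p * q - 1" using d(3) s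
    by (simp add: dvd_add_right_iff)
  then obtain k where k: "p * q - 1 = s * k" by (auto simp: dvd_def)
  have pq: "p * q > 1" using p1 h by (intro less_1_mult) auto
  have "k \<noteq> 0" using k pq by (metis mult_0_right not_less_iff_gr_or_eq zero_less_diff)
  moreover have "k \<noteq> 1"
  proof
    assume "k = 1"
    then have "p * q = r" using k s pq by simp
    then have "prime (p * q)" using pr by simp
    then have "p = 1 \<or> q = 1" by (rule prime_product)
    then show False using p1 h by simp
  qed
  ultimately have "k \<ge> 2" by simp
  moreover have "K3N_E p q r = real k" using h s k by (simp add: K3N_E_def del: of_nat_mult) simp
  ultimately have "K3N_E p q r \<ge> 2" by simp
  then show "K3N n p q r \<and> prime p \<and> prime q \<and> prime r"
    using h pr d p1 podd qodd rodd by (simp add: K3N_def)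
next
  assume "K3N n p q r \<and> prime p \<and> prime q \<and> prime r"
  then show "C3N n p q r"
    using carmichael_number_pqr_iff[of p q r n] by (auto simp: K3N_def C3N_def)
qed

end

theory Submission
  imports Defs
begin

text \<open>
  Write $p - 1 = HA$, $q - 1 = HB$, $r - 1 = HC$; then $A$ is coprime to $B$. With
  $D = (pr-1)/(q-1)$ one has $(DE - p^2)B = A(p+E)$, so $B$ divides $p + E < 2p$. If $B \<noteq> p + E$,
  then $B < p$. Otherwise $E = p - s$ and $B = 2p - s$ with $p - s \mid s^2 + A$, and the
  coprimality gives $H + 1 = At$ with $t$ odd, hence $p = tA^2 - A + 1$. So $A$ is about
  $\sqrt{p/t}$ at most, and $s^2 + A \<ge> p - s$ bounds $s$ from below: $t \<ge> 3$ gives (a) and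
  $t \<ge> 7$ gives (b), while $t = 1$ is better than either. For primes, $t = 3$ and $t = 5$ could
  only violate (b) when $s^2 + A = p - s$; this forces $3$ to divide $pqr$ if $t = 3$, and is
  impossible modulo $9$ if $t = 5$.
\<close>

section \<open>Arithmetic of the quotients \<open>A\<close>, \<open>B\<close>, \<open>C\<close>,
  \<open>D\<close>, \<open>E\<close>\<close>

lemma K3N_parameters:
  assumes "K3N n p q r"
  obtains H A B C D E :: int where
    "int p = H * A + 1" "int q = H * B + 1" "int r = H * C + 1"
    "even H" "H > 0" "A > 0" "A < B" "B < C" "coprime A B"
    "E * C = A + int p * B" "D * B = H * A * C + A + C" "A dvd H * B * C + B + C"
    "K3N_B p q r = real_of_int B"
proof -
  have n: "n = p * q * r" and ord: "1 < p" "p < q" "q < r" and od: "odd p" "odd q" "odd r"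
    and dv: "(p - 1) dvd (n - 1)" "(q - 1) dvd (n - 1)" "(r - 1) dvd (n - 1)"
    using assms by (auto simp: K3N_def)
  define h where "h = K3N_H p q r"
  have hgcd: "h = gcd (p - 1) (gcd (q - 1) (r - 1))" by (simp add: h_def K3N_H_def)
  have h0: "h > 0" using ord hgcd by auto
  have "h dvd p - 1" "h dvd q - 1" "h dvd r - 1"
    unfolding hgcd by (meson gcd_dvd1 gcd_dvd2 dvd_trans)+
  then obtain a b c where abc: "p - 1 = h * a" "q - 1 = h * b" "r - 1 = h * c"
    by (auto elim!: dvdE)
  have p: "p = h * a + 1" and q: "q = h * b + 1" and r: "r = h * c + 1"
    using abc ord by auto
  have "2 dvd h" unfolding hgcd using od ord by auto
  have "h * gcd a (gcd b c) = h"
    using hgcd unfolding abc by (metis gcd_mult_distrib_nat)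
  then have g1: "gcd a (gcd b c) = 1" using h0 by simp
  define H A B C where "H = int h" "A = int a" "B = int b" "C = int c"
  note defs = this
  have P: "int p = H * A + 1" and Q: "int q = H * B + 1" and R: "int r = H * C + 1"
    using p q r by (simp_all add: defs)
  have H: "even H" "H > 0" using h0 \<open>2 dvd h\<close> by (auto simp: defs)
  have "h * a > 0" "h * a < h * b" "h * b < h * c" using ord p q r by auto
  then have A: "A > 0" "A < B" "B < C" by (auto simp: defs)
  have n1: "int (n - 1) = int p * int q * int r - 1"
  proof -
    have "n \<ge> 1" using n ord by (simp add: Suc_le_eq)
    then show ?thesis using n by (simp add: of_nat_diff)
  qed
  \<comment> \<open>This is \<open>n - 1 = (p - 1) * q * r + (q * r - 1)\<close> and its two
    analogues, with the factor \<open>H\<close> taken out; the last summand carries the divisibility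
    condition.\<close>
  have nA: "int (n - 1) = H * (A * (H * H * B * C + H * B + H * C + 1) + (H * B * C + B + C))"
    and nB: "int (n - 1) = H * (B * (H * H * A * C + H * A + H * C + 1) + (H * A * C + A + C))"
    and nC: "int (n - 1) = H * (C * (H * H * A * B + H * A + H * B + 1) + (H * A * B + A + B))"
    unfolding n1 P Q R by (simp_all add: algebra_simps)
  have hA: "H * A dvd int (n - 1)" and hB: "H * B dvd int (n - 1)"
    and hC: "H * C dvd int (n - 1)"
    using dv unfolding abc defs of_nat_mult [symmetric] int_dvd_int_iff by auto
  have dA: "A dvd H * B * C + B + C"
    using hA H(2) unfolding nA by (simp add: dvd_add_right_iff)
  have dB: "B dvd H * A * C + A + C"
    using hB H(2) unfolding nB by (simp add: dvd_add_right_iff)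
  have dC: "C dvd H * A * B + A + B"
    using hC H(2) unfolding nC by (simp add: dvd_add_right_iff)
  have G1: "gcd A (gcd B C) = 1" using g1 by (simp add: defs)
  \<comment> \<open>A common divisor of \<open>A\<close> and \<open>B\<close> divides
    \<open>H * B * C + B + C\<close>, hence \<open>C\<close>; as \<open>A\<close>, \<open>B\<close>,
    \<open>C\<close> have no common factor, \<open>A\<close> and \<open>B\<close> are already
    coprime.\<close>
  have "gcd A B dvd C"
  proof -
    have "gcd A B dvd H * B * C + B + C" using dA by (meson dvd_trans gcd_dvd1)
    moreover have "gcd A B dvd H * B * C + B" by simp
    ultimately show ?thesis using dvd_add_right_iff by blast
  qed
  then have "gcd A B dvd gcd A (gcd B C)" by simp
  then have cAB: "coprime A B" using G1 by (simp add: coprime_iff_gcd_eq_1)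
  obtain D where D: "D * B = H * A * C + A + C" using dB by (metis dvdE mult.commute)
  obtain E where "H * A * B + A + B = C * E" using dC by (auto elim: dvdE)
  then have E: "E * C = A + int p * B" unfolding P by (simp add: algebra_simps)
  have KB: "K3N_B p q r = real_of_int B"
    using h0 unfolding K3N_B_def h_def [symmetric] abc by (simp add: defs)
  show thesis
    by (rule that [OF P Q R H A cAB E D dA KB])
qed

lemma large_B_form:
  fixes H A B C D E p :: int
  assumes p: "p = H * A + 1" and "H > 0" "A > 0" "B > 0" "B < C"
    and "coprime A B"
    and E: "E * C = A + p * B" and D: "D * B = H * A * C + A + C"
    and dA: "A dvd H * B * C + B + C" and "B \<ge> p"
  obtains s t where "s > 0" "s < p" "B = 2 * p - s" "H + 1 = A * t" "(p - s) dvd s\<^sup>2 + A"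
    "(p - s) * C = A + p * B"
proof -
  have HA: "H * A > 0" using assms by simp
  have "p > 0" using p HA by simp
  have E0: "E > 0"
  proof -
    have "E * C > 0" using E \<open>A > 0\<close> \<open>p > 0\<close> \<open>B > 0\<close> by (simp add: add_pos_pos)
    then show ?thesis using \<open>B > 0\<close> \<open>B < C\<close> by (simp add: zero_less_mult_iff)
  qed
  \<comment> \<open>If \<open>E \<ge> p\<close>, then
    \<open>A + p * B = E * C \<ge> p * (B + 1)\<close> forces \<open>p \<le> A\<close>, against
    \<open>p = H * A + 1\<close>.\<close>
  have Ep: "E < p"
  proof (rule ccontr)
    assume "\<not> E < p"
    then have "p * C \<le> E * C" using \<open>B > 0\<close> \<open>B < C\<close> by (intro mult_right_mono) auto
    moreover have "p * C \<ge> p * (B + 1)" using \<open>p > 0\<close> \<open>B < C\<close> by (intro mult_left_mono) auto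
    ultimately have "p \<le> A" using E by (simp add: algebra_simps)
    moreover have "A * 1 \<le> A * H" using \<open>H > 0\<close> \<open>A > 0\<close> by (intro mult_left_mono) auto
    ultimately show False using p by (simp add: mult.commute)
  qed
  \<comment> \<open>Multiplying the equation for \<open>D * B\<close> by \<open>E\<close> makes
    \<open>C\<close> occur only in \<open>E * C\<close>, so \<open>C\<close> can be
    eliminated.\<close>
  have key: "(D * E - p\<^sup>2) * B = A * (p + E)"
  proof -
    have "D * E * B = E * (D * B)" by simp
    also have "\<dots> = (E * C) * p + E * A" unfolding D by (simp add: p algebra_simps)
    also have "\<dots> = p\<^sup>2 * B + A * (p + E)"
      unfolding E by (simp add: power2_eq_square algebra_simps)
    finally show ?thesis by (simp add: algebra_simps)
  qed
  have "B dvd A * (p + E)" using key by (metis dvd_triv_right)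
  then have "B dvd p + E"
    using \<open>coprime A B\<close> by (simp add: coprime_commute coprime_dvd_mult_right_iff)
  then obtain k where k: "p + E = B * k" by (auto elim: dvdE)
  \<comment> \<open>Here \<open>B \<ge> p\<close> enters:
    \<open>p + E < 2 * p \<le> 2 * B\<close>.\<close>
  have "k = 1"
  proof (rule ccontr)
    assume "k \<noteq> 1"
    moreover have "k > 0" using k \<open>p > 0\<close> E0 \<open>B > 0\<close>
      by (metis add_pos_pos zero_less_mult_pos)
    ultimately have "B * 2 \<le> B * k" using \<open>B > 0\<close> by (intro mult_left_mono) auto
    then show False using k Ep \<open>B \<ge> p\<close> by simp
  qed
  then have B: "B = p + E" using k by simp
  have DE: "D * E = p\<^sup>2 + A"
  proof -
    have "(D * E - p\<^sup>2) * B = A * B" using key B by simp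
    then show ?thesis using \<open>B > 0\<close> by simp
  qed
  define s where "s = p - E"
  \<comment> \<open>\<open>E\<close> divides \<open>p\<^sup>2 + A\<close>, and \<open>p\<close> is
    congruent to \<open>s\<close> modulo \<open>E\<close>.\<close>
  have "E dvd s\<^sup>2 + A"
  proof -
    have "s\<^sup>2 + A = E * (D + E - 2 * p)"
      using DE unfolding s_def by (simp add: power2_eq_square algebra_simps)
    then show ?thesis by simp
  qed
  \<comment> \<open>Modulo \<open>A\<close> one has \<open>p = 1\<close>, \<open>E = B - 1\<close>
    and \<open>E * C = B\<close>; substituting these into \<open>E * (H * B * C + B + C)\<close>, a
    multiple of \<open>A\<close>, leaves \<open>B\<^sup>2 * (H + 1)\<close>.\<close>
  have "A dvd B\<^sup>2 * (H + 1)"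
  proof -
    have E': "E = B - H * A - 1" using B p by simp
    have "E * (H * B * C + B + C) = (H * B + 1) * (E * C) + E * B"
      by (simp add: algebra_simps)
    also have "\<dots> = B\<^sup>2 * (H + 1) + A * ((1 + H * B)\<^sup>2 - H * B)"
      unfolding E by (simp add: E' p power2_eq_square algebra_simps)
    finally have "B\<^sup>2 * (H + 1) = E * (H * B * C + B + C) - A * ((1 + H * B)\<^sup>2 - H * B)"
      by simp
    then show ?thesis using dA by (metis dvd_diff dvd_mult dvd_triv_left)
  qed
  then have "A dvd H + 1"
    using \<open>coprime A B\<close> by (simp add: coprime_dvd_mult_right_iff)
  then obtain t where "H + 1 = A * t" by (auto elim: dvdE)
  then show thesis
    using that [of s t] B Ep E0 E \<open>E dvd s\<^sup>2 + A\<close> by (simp add: s_def)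
qed

section \<open>Lower bounds for the offset \<open>s = 2 * p - B\<close>\<close>

text \<open>Read \<open>x\<close> as \<open>sqrt (p - 3 / 4)\<close>. Lowering \<open>x\<close> by
  \<open>1 / (2 * sqrt T)\<close> lowers its square by about \<open>x / sqrt T\<close>. The first
  bound on \<open>x\<^sup>2\<close> makes this large enough to absorb the term \<open>- A\<close> in
  the bound on \<open>s\<^sup>2 + s\<close>.\<close>

lemma offset_lower_bound:
  fixes A s x T :: real
  assumes T: "T \<ge> 1" and "s \<ge> 0" and x: "x\<^sup>2 \<ge> T * A\<^sup>2 - A + 1 / 4"
    and "x \<ge> 0" and s: "s\<^sup>2 + s \<ge> x\<^sup>2 + 3 / 4 - A"
  shows "s > x - 1 / 2 - 1 / (2 * sqrt T)"
proof (rule ccontr)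
  define u where "u = sqrt T"
  have u: "u \<ge> 1" "u\<^sup>2 = T" using T by (auto simp: u_def)
  assume "\<not> ?thesis"
  then have "s + 1 / 2 \<le> x - 1 / (2 * u)" by (simp add: u_def)
  then have "(s + 1 / 2)\<^sup>2 \<le> (x - 1 / (2 * u))\<^sup>2" using \<open>s \<ge> 0\<close> by (intro power_mono) auto
  then have "x\<^sup>2 + 1 - A \<le> x\<^sup>2 - x / u + 1 / (4 * T)"
    using s u by (simp add: power2_sum power2_diff power_divide power_mult_distrib)
  moreover have "1 / (4 * T) \<le> 1 / 4" using T by (simp add: divide_simps)
  ultimately have "x / u \<le> A - 3 / 4" by simp
  then have "x \<le> (A - 3 / 4) * u" using u by (simp add: divide_simps)
  moreover have "A - 3 / 4 \<ge> 0"
    using \<open>x / u \<le> A - 3 / 4\<close> \<open>x \<ge> 0\<close> u by (smt (verit) divide_nonneg_nonneg)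
  ultimately have "x\<^sup>2 \<le> ((A - 3 / 4) * u)\<^sup>2" using \<open>x \<ge> 0\<close> by (intro power_mono) auto
  also have "\<dots> = (A - 3 / 4)\<^sup>2 * T" using u by (simp add: power_mult_distrib)
  finally have "T * A\<^sup>2 - A + 1 / 4 \<le> (A - 3 / 4)\<^sup>2 * T" using x by simp
  \<comment> \<open>The terms \<open>T * A\<^sup>2\<close> cancel. With \<open>T \<ge> 1\<close>
    what remains gives \<open>A \<le> 5 / 8\<close>, against \<open>A \<ge> 3 / 4\<close>.\<close>
  then have "T * (3 / 2 * A - 9 / 16) \<le> A - 1 / 4"
    by (simp add: power2_eq_square algebra_simps)
  moreover have "1 * (3 / 2 * A - 9 / 16) \<le> T * (3 / 2 * A - 9 / 16)"
    using T \<open>A - 3 / 4 \<ge> 0\<close> by (intro mult_right_mono) auto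
  ultimately have "1 * (3 / 2 * A - 9 / 16) \<le> A - 1 / 4" by (rule order_trans [rotated])
  then show False using \<open>A - 3 / 4 \<ge> 0\<close> by simp
qed

lemma bound_of_offset:
  fixes B p s c :: real
  assumes "B = 2 * p - s" "s > sqrt (p - 3 / 4) - 1 / 2 - 1 / (2 * sqrt T)" "T > 0"
  shows "B < 2 * p - sqrt (p - 3 / 4) + (sqrt T + 1) / (2 * sqrt T)"
proof -
  have "(sqrt T + 1) / (2 * sqrt T) = 1 / 2 + 1 / (2 * sqrt T)"
    using \<open>T > 0\<close> by (simp add: field_simps)
  then show ?thesis using assms by simp
qed

text \<open>The quotient \<open>m\<close> of \<open>s\<^sup>2 + A\<close> by \<open>p - s\<close> is
  the main parameter: \<open>m \<ge> 2\<close> makes \<open>s\<close> larger by a constant factor,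
  so the size of \<open>t\<close> matters only in the tight case \<open>m = 1\<close>. For
  \<open>t = 1\<close> the number \<open>p - 3 / 4\<close> is a perfect square and integrality of
  \<open>s\<close> gives the bound.\<close>

lemma extremal_bound:
  fixes A s t p H :: int and T :: real
  assumes p: "p = H * A + 1" and t: "H + 1 = A * t" and "H \<ge> 2" "A > 0" "s > 0" "s < p"
    and dvd: "(p - s) dvd s\<^sup>2 + A" and T: "T \<ge> 1"
    and gap: "t = 1 \<or> real_of_int t \<ge> T \<or> s\<^sup>2 + A \<noteq> p - s"
  shows "s > sqrt (p - 3 / 4) - 1 / 2 - 1 / (2 * sqrt T)"
proof -
  define x where "x = sqrt (real_of_int p - 3 / 4)"
  have pA: "p = t * A\<^sup>2 - A + 1"
    using p t by (metis (no_types, opaque_lifting) add_diff_cancel_right' add.commute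
        diff_add_eq left_diff_distrib mult.assoc mult.commute mult_1 power2_eq_square)
  have "p \<ge> 1" using p \<open>H \<ge> 2\<close> \<open>A > 0\<close> by simp
  have x: "x\<^sup>2 = p - 3 / 4" "x \<ge> 0" using \<open>p \<ge> 1\<close> by (auto simp: x_def)
  have posT: "1 / (2 * sqrt T) > 0" using T by simp
  obtain m where m: "s\<^sup>2 + A = (p - s) * m" using dvd by (auto elim: dvdE)
  have "s\<^sup>2 + A > 0" using \<open>A > 0\<close> by (simp add: add_nonneg_pos)
  then have "m > 0" using m \<open>s < p\<close> by (metis diff_gt_0_iff_gt zero_less_mult_pos)
  then have "(p - s) * 1 \<le> (p - s) * m" using \<open>s < p\<close> by (intro mult_left_mono) auto
  then have s1: "s\<^sup>2 + s \<ge> p - A" using m by simp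
  consider "t = 1" | "real_of_int t \<ge> T" | "m \<noteq> 1" using gap m by auto
  then have "s > x - 1 / 2 - 1 / (2 * sqrt T)"
  proof cases
    case 1
    \<comment> \<open>For \<open>t = 1\<close>,
      \<open>s * (s + 1) \<ge> p - A = (A - 1)\<^sup>2\<close>, which exceeds
      \<open>(A - 2) * (A - 1)\<close>.\<close>
    have "s \<ge> A - 1"
    proof (rule ccontr)
      assume "\<not> ?thesis"
      then have "s + 1 \<le> A - 1" "s \<le> A - 1" by auto
      then have "s * (s + 1) \<le> (A - 1 - 1) * (A - 1)" using \<open>s > 0\<close> by (intro mult_mono) auto
      then show False using s1 pA 1 \<open>s + 1 \<le> A - 1\<close> \<open>s > 0\<close>
        by (simp add: power2_eq_square algebra_simps)
    qed
    have "x\<^sup>2 = (A - 1 / 2)\<^sup>2"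
      unfolding x pA 1 by (simp add: power2_eq_square algebra_simps)
    then have "x = A - 1 / 2" using x \<open>A > 0\<close> by (simp add: power2_eq_iff_nonneg)
    then show ?thesis using \<open>s \<ge> A - 1\<close> posT by linarith
  next
    case 2
    have "T * (real_of_int A)\<^sup>2 \<le> t * (real_of_int A)\<^sup>2" using 2 by (intro mult_right_mono) auto
    then have "x\<^sup>2 \<ge> T * (real_of_int A)\<^sup>2 - A + 1 / 4" unfolding x pA by simp
    moreover have "real_of_int (s\<^sup>2 + s) \<ge> real_of_int (p - A)" using s1 by linarith
    ultimately show ?thesis
      using x T \<open>A > 0\<close> \<open>s > 0\<close> by (intro offset_lower_bound [where T = T and A = A]) auto
  next
    case 3
    then have "(p - s) * 2 \<le> (p - s) * m"
      using \<open>m > 0\<close> \<open>s < p\<close> by (intro mult_left_mono) auto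
    moreover have "2 * A \<le> H * A" using \<open>H \<ge> 2\<close> \<open>A > 0\<close> by (intro mult_right_mono) auto
    \<comment> \<open>Double \<open>s\<^sup>2 + A \<ge> 2 * (p - s)\<close> and bound
      \<open>2 * A\<close> by \<open>H * A = p - 1\<close>. The result is stronger than required:
      \<open>s > x - 1 / 2\<close>.\<close>
    ultimately have "3 * p \<le> 2 * s\<^sup>2 + 4 * s" using m p by simp
    then have "real_of_int (3 * p) \<le> real_of_int (2 * s\<^sup>2 + 4 * s)"
      by (rule of_int_le_iff [THEN iffD2])
    then have "3 * p \<le> 2 * (real_of_int s)\<^sup>2 + 4 * s" by simp
    then have "2 * (real_of_int s + 1)\<^sup>2 \<ge> 3 * x\<^sup>2 + 4"
      unfolding x by (simp add: power2_eq_square algebra_simps)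
    moreover have "3 * x\<^sup>2 + 4 > 2 * (x + 1 / 2)\<^sup>2"
    proof -
      have "(x - 1)\<^sup>2 \<ge> 0" by simp
      then show ?thesis by (simp add: power2_eq_square algebra_simps)
    qed
    ultimately have "(x + 1 / 2)\<^sup>2 < (real_of_int s + 1)\<^sup>2" by simp
    then have "x + 1 / 2 < real_of_int s + 1" using \<open>s > 0\<close>
      by (simp add: power2_less_imp_less)
    then show ?thesis using posT by linarith
  qed
  then show ?thesis by (simp add: x_def)
qed

lemma cofactor_odd:
  fixes A t H :: int
  assumes "H + 1 = A * t" "even H" "H \<ge> 2" "A > 0"
  shows "odd t" "t \<ge> 1"
proof -
  have "odd (A * t)" using assms by (metis even_plus_one_iff)
  then show "odd t" by auto
  have "A * t > 0" using assms by simp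
  then show "t \<ge> 1" using \<open>A > 0\<close> by (simp add: zero_less_mult_iff)
qed

section \<open>Congruences for the tight case \<open>s\<^sup>2 + A = p - s\<close> with
  \<open>t = 5\<close> and \<open>t = 3\<close>\<close>

text \<open>The excluded equation is the tight case with
  \<open>p = 5 * A\<^sup>2 - A + 1\<close>.\<close>

lemma no_tight_offset_5:
  fixes A s :: int
  shows "s\<^sup>2 + s \<noteq> 5 * A\<^sup>2 - 2 * A + 1"
proof
  assume s: "s\<^sup>2 + s = 5 * A\<^sup>2 - 2 * A + 1"
  \<comment> \<open>These complete the squares on both sides after multiplication by 20.\<close>
  define u w where "u = 2 * s + 1" and "w = 5 * A - 1"
  have "5 * u\<^sup>2 = 20 * (s\<^sup>2 + s) + 5"
    by (simp add: u_def power2_eq_square algebra_simps)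
  also have "\<dots> = 4 * w\<^sup>2 + 21"
    unfolding s by (simp add: w_def power2_eq_square algebra_simps)
  finally have eq: "5 * u\<^sup>2 = 4 * w\<^sup>2 + 21" .
  \<comment> \<open>Modulo 3 the equation reads \<open>2 * u\<^sup>2 = w\<^sup>2\<close>, and 2 is
    not a square. Then 9 would have to divide 21.\<close>
  have "u mod 3 = 0 \<and> w mod 3 = 0"
  proof -
    have "(5 * u\<^sup>2) mod 3 = (4 * w\<^sup>2 + 21) mod 3" using eq by simp
    then have "(5 * (u mod 3)\<^sup>2) mod 3 = (4 * (w mod 3)\<^sup>2 + 21) mod 3"
      by (metis (no_types, opaque_lifting) mod_add_left_eq mod_mult_right_eq power_mod)
    moreover have "u mod 3 \<in> {0, 1, 2}" "w mod 3 \<in> {0, 1, 2}" by auto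
    ultimately show ?thesis by auto
  qed
  then obtain a b where "u = 3 * a" "w = 3 * b" by (auto elim!: dvdE simp: mod_eq_0_iff_dvd)
  then have "15 * a\<^sup>2 = 12 * b\<^sup>2 + 7" using eq by (simp add: power_mult_distrib)
  then show False by presburger
qed

text \<open>For \<open>t = 3\<close>, \<open>H = 3 * A - 1\<close> is -1 modulo 3, so the last two
  alternatives say that 3 divides \<open>q = H * B + 1\<close> or \<open>r = H * C + 1\<close>,
  where \<open>B = 2 * p - s\<close> and \<open>C = 2 * p + s + 1\<close>.\<close>

lemma tight_offset_3_divisible:
  fixes A s p :: int
  assumes p: "p = 3 * A\<^sup>2 - A + 1" and s: "s\<^sup>2 + A = p - s"
  shows "3 dvd p \<or> 3 dvd 1 - (2 * p - s) \<or> 3 dvd 1 - (2 * p + s + 1)"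
proof -
  define j m where "j = s div 3" and "m = s mod 3"
  have sj: "s = 3 * j + m" by (simp add: j_def m_def)
  \<comment> \<open>Replacing the linear \<open>A\<close> by \<open>p - s - s\<^sup>2\<close> leaves
    \<open>A\<close> only in a multiple of 3, so the residue of \<open>s\<close> alone decides which
    alternative holds.\<close>
  have p2: "2 * p = 3 * A\<^sup>2 + s\<^sup>2 + s + 1" using p s by simp
  have s2: "s\<^sup>2 = 3 * (3 * j\<^sup>2 + 2 * j * m) + m\<^sup>2"
    unfolding sj by (simp add: power2_eq_square algebra_simps)
  have "m = 0 \<or> m = 1 \<or> m = 2" unfolding m_def by presburger
  then consider "m = 0" | "m = 1" | "m = 2" by blast
  then show ?thesis
  proof cases
    case 1
    then have "1 - (2 * p - s) = 3 * (- A\<^sup>2 - 3 * j\<^sup>2)" using p2 s2 sj by simp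
    then show ?thesis by (metis dvd_triv_left)
  next
    case 2
    then have "2 * p = 3 * (A\<^sup>2 + 3 * j\<^sup>2 + 3 * j + 1)" using p2 s2 sj by simp
    then have "3 dvd 2 * p" by (metis dvd_triv_left)
    then show ?thesis by presburger
  next
    case 3
    then have "1 - (2 * p + s + 1) = 3 * (- A\<^sup>2 - 3 * j\<^sup>2 - 6 * j - 3)"
      using p2 s2 sj by simp
    then show ?thesis by (metis dvd_triv_left)
  qed
qed

section \<open>The bound on \<open>B\<close> for a general threshold \<open>T\<close>, then for 3
  and 7\<close>

text \<open>The hypothesis \<open>gap\<close> isolates what depends on the kind of factors: in the
  tight case no \<open>t\<close> other than 1 lies below \<open>T\<close>. It excludes
  \<open>p = 3\<close>, since divisibility by 3 is no contradiction there.\<close>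

lemma K3N_B_bound:
  fixes T :: real
  assumes K: "K3N n p q r" and T: "T \<ge> 1"
    and gap: "\<And>H A s t :: int. \<lbrakk>int p = H * A + 1; int q = H * (2 * int p - s) + 1;
      H + 1 = A * t; even H; H \<ge> 2; A > 0; s\<^sup>2 + A = int p - s;
      int r = H * (2 * int p + s + 1) + 1; p \<noteq> 3\<rbrakk> \<Longrightarrow> t = 1 \<or> t \<ge> T"
  shows "K3N_B p q r < 2 * real p - sqrt (real p - 3 / 4) + (sqrt T + 1) / (2 * sqrt T)"
proof -
  obtain H A B C D E :: int where
    P: "int p = H * A + 1" and Q: "int q = H * B + 1" and R: "int r = H * C + 1"
    and H: "even H" "H > 0" and A: "A > 0" "A < B" "B < C" and cop: "coprime A B"
    and E: "E * C = A + int p * B" and D: "D * B = H * A * C + A + C"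
    and dA: "A dvd H * B * C + B + C" and KB: "K3N_B p q r = real_of_int B"
    using K by (rule K3N_parameters)
  have p1: "p > 1" using K by (auto simp: K3N_def)
  have H2: "H \<ge> 2" using H by presburger
  show ?thesis
  proof (cases "B < int p")
    case True
    \<comment> \<open>The square root is at most \<open>p\<close>, so the claimed bound already
      exceeds \<open>p > B\<close>.\<close>
    have "real p \<le> (real p)\<^sup>2" using p1 by (intro self_le_power) linarith+
    then have "sqrt (real p - 3 / 4) \<le> real p" by (intro real_le_lsqrt) linarith+
    moreover have "(sqrt T + 1) / (2 * sqrt T) > 0" using T by (simp add: add_pos_pos)
    ultimately show ?thesis using True unfolding KB by linarith
  next
    case False
    then have Bp: "B \<ge> int p" by simp
    obtain s t where s: "s > 0" "s < int p" "B = 2 * int p - s" and t: "H + 1 = A * t"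
      and dvd: "(int p - s) dvd s\<^sup>2 + A"
      and C: "(int p - s) * C = A + int p * B"
      using large_B_form [OF P H(2) A(1) _ A(3) cop E D dA Bp] A by auto
    have "real_of_int s > sqrt (real p - 3 / 4) - 1 / 2 - 1 / (2 * sqrt T)"
    proof (cases "p = 3")
      case True
      \<comment> \<open>For \<open>p = 3\<close> the required lower bound is below 1, and
        \<open>s \<ge> 1\<close>.\<close>
      have "sqrt (real p - 3 / 4) = 3 / 2"
        unfolding True by (rule real_sqrt_unique) (auto simp: power2_eq_square)
      moreover have "1 / (2 * sqrt T) > 0" using T by simp
      ultimately show ?thesis using s(1) by linarith
    next
      case False
      have "t = 1 \<or> t \<ge> T \<or> s\<^sup>2 + A \<noteq> int p - s"
      proof (cases "s\<^sup>2 + A = int p - s")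
        case True
        \<comment> \<open>Tightness turns \<open>A + p * B\<close> into a polynomial in
          \<open>p\<close> and \<open>s\<close> divisible by \<open>p - s\<close>, which determines
          \<open>C\<close>.\<close>
        have "(int p - s) * C = (int p - s) * (2 * int p + s + 1)"
        proof -
          have A': "A = int p - s - s\<^sup>2" using True by simp
          show ?thesis unfolding C s(3) A' by (simp add: power2_eq_square algebra_simps)
        qed
        then have "C = 2 * int p + s + 1" using s by simp
        then show ?thesis using gap [of H A s t] P Q R H H2 A t s True False by auto
      qed auto
      then show ?thesis using extremal_bound [OF P t H2 A(1) s(1,2) dvd T] by simp
    qed
    then show ?thesis
      using bound_of_offset [of B p s T] s T unfolding KB by simp
  qed
qed

theorem theorem4p3:
  shows "(\<forall>n p q r. K3N n p q r \<longrightarrow>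
            K3N_B p q r < 2 * real p - sqrt (real p - 3 / 4) + (sqrt 3 + 1) / (2 * sqrt 3)) \<and>
         (\<forall>n p q r. C3N n p q r \<longrightarrow>
            K3N_B p q r < 2 * real p - sqrt (real p - 3 / 4) + (sqrt 7 + 1) / (2 * sqrt 7))"
proof (intro conjI allI impI)
  fix n p q r assume "K3N n p q r"
  then show "K3N_B p q r < 2 * real p - sqrt (real p - 3 / 4) + (sqrt 3 + 1) / (2 * sqrt 3)"
  proof (rule K3N_B_bound)
    fix H A s t :: int
    assume "H + 1 = A * t" "even H" "H \<ge> 2" "A > 0"
    from cofactor_odd [OF this] have "t = 1 \<or> t \<ge> 3" by presburger
    then show "t = 1 \<or> t \<ge> (3::real)" by simp
  qed simp
next
  fix n p q r assume "C3N n p q r"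
  then have K: "K3N n p q r" and pr: "prime p" "prime q" "prime r"
    by (auto simp: C3N_iff_K3N)
  then have ord: "p < q" "q < r" by (auto simp: K3N_def)
  show "K3N_B p q r < 2 * real p - sqrt (real p - 3 / 4) + (sqrt 7 + 1) / (2 * sqrt 7)"
    using K
  proof (rule K3N_B_bound)
    fix H A s t :: int
    assume P: "int p = H * A + 1" and Q: "int q = H * (2 * int p - s) + 1" and t: "H + 1 = A * t"
      and H: "even H" "H \<ge> 2" and A: "A > 0" and s: "s\<^sup>2 + A = int p - s"
      and R: "int r = H * (2 * int p + s + 1) + 1" and p3: "p \<noteq> 3"
    have H': "H = A * t - 1" using t by simp
    have pA: "int p = t * A\<^sup>2 - A + 1" unfolding P H'
      by (simp add: power2_eq_square algebra_simps)
    have "t \<noteq> 5" using no_tight_offset_5 [of s A] s pA by auto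
    moreover have "t \<noteq> 3"
    proof
      assume 3: "t = 3"
      define X Y where "X = 2 * int p - s" and "Y = 2 * int p + s + 1"
      have "int q = 3 * (A * X) + (1 - X)" "int r = 3 * (A * Y) + (1 - Y)"
        using Q R by (simp_all add: H' 3 X_def [symmetric] Y_def [symmetric] left_diff_distrib)
      moreover have "3 dvd int p \<or> 3 dvd 1 - X \<or> 3 dvd 1 - Y"
        using tight_offset_3_divisible [of "int p" A s] pA s 3 by (simp add: X_def Y_def)
      ultimately have "3 dvd int p \<or> 3 dvd int q \<or> 3 dvd int r"
        by (auto intro: dvd_add)
      then have "3 dvd p \<or> 3 dvd q \<or> 3 dvd r"
        using int_dvd_int_iff [of 3] by simp
      moreover have "prime (3 :: nat)" by simp
      \<comment> \<open>Primality enters here: a factor divisible by 3 equals 3, but all three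
        exceed 3.\<close>
      ultimately have "3 = p \<or> 3 = q \<or> 3 = r"
        using pr primes_dvd_imp_eq by blast
      moreover have "p > 2"
      proof -
        have "odd p" "p > 1" using K by (simp_all add: K3N_def)
        then show ?thesis by presburger
      qed
      ultimately show False using p3 ord by auto
    qed
    ultimately have "t = 1 \<or> t \<ge> 7"
      using cofactor_odd [OF t H A] by presburger
    then show "t = 1 \<or> t \<ge> (7::real)" by simp
  qed simp
qed

end
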